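(* There exist universal constants $0<c_1<c_2<1$ such that for every prime $p\geq 3$ there is $n_0(p)\in\mathbb{N}$ such that for all $n\geq n_0(p)$, \[ (c_1p)^n\leq \mathrm{ex}^{\sharp}_{\mathrm{W},p}(n)\leq (c_2p)^n . \]
   Context: For a prime $p\geq 3$, consider the system of linear equations over $\mathbb{F}_p$ in five variables $x_1,\dots,x_5\in\mathbb{F}_p^n$: $x_1-x_2-x_3+x_4=0$ and $x_1-2x_3+x_5=0$. Define $\mathrm{ex}^{\sharp}_{\mathrm{W},p}(n)$ to be the maximum of $\#A$ over all subsets $A\subseteq\mathbb{F}_p^n$ that admit no solution $(x_1,x_2,x_3,x_4,x_5)\in A^5$ of this system with $x_1,\dots,x_5$ pairwise distinct. *)

theory Defs
  imports Complex_Main "HOL-Number_Theory.Number_Theory" "HOL-Library.FuncSet"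
begin

(* F_p^n: the prime p and the dimension n are quantified inside the theorem, so both are
   carried by terms. A vector is an extensional function on {..<n} whose values are the
   canonical residues {0..p - 1}, the carrier of the library's residue ring. *)
definition Fp_vectors :: "nat \<Rightarrow> nat \<Rightarrow> (nat \<Rightarrow> int) set" where
  "Fp_vectors p n = {..<n} \<rightarrow>\<^sub>E carrier (residue_ring (int p))"

(* Linear equations over F_p are coordinatewise congruences of the integer representatives. *)
definition W_system ::
  "nat \<Rightarrow> nat \<Rightarrow> (nat \<Rightarrow> int) \<Rightarrow> (nat \<Rightarrow> int) \<Rightarrow> (nat \<Rightarrow> int) \<Rightarrow> (nat \<Rightarrow> int) \<Rightarrow> (nat \<Rightarrow> int) \<Rightarrow> bool"
where
  "W_system p n x1 x2 x3 x4 x5 \<longleftrightarrow>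
     (\<forall>i<n. [x1 i - x2 i - x3 i + x4 i = 0] (mod int p)) \<and>
     (\<forall>i<n. [x1 i - 2 * x3 i + x5 i = 0] (mod int p))"

definition W_sharp_free :: "nat \<Rightarrow> nat \<Rightarrow> (nat \<Rightarrow> int) set \<Rightarrow> bool" where
  "W_sharp_free p n A \<longleftrightarrow>
     \<not> (\<exists>x1\<in>A. \<exists>x2\<in>A. \<exists>x3\<in>A. \<exists>x4\<in>A. \<exists>x5\<in>A.
          distinct [x1, x2, x3, x4, x5] \<and> W_system p n x1 x2 x3 x4 x5)"

definition ex_W_sharp :: "nat \<Rightarrow> nat \<Rightarrow> nat" where
  "ex_W_sharp p n = Max {card A | A. A \<subseteq> Fp_vectors p n \<and> W_sharp_free p n A}"

lemma finite_Fp_vectors: "finite (Fp_vectors p n)"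
  by (auto simp: Fp_vectors_def residue_ring_def intro!: finite_PiE)

lemma card_Fp_vectors: "card (Fp_vectors p n) = p ^ n"
  by (simp add: Fp_vectors_def residue_ring_def card_PiE)

(* The maximum ranges over a finite nonempty set, so Max is not underspecified here. *)
lemma ex_W_sharp_set:
  "finite {card A | A. A \<subseteq> Fp_vectors p n \<and> W_sharp_free p n A}"
  "{card A | A. A \<subseteq> Fp_vectors p n \<and> W_sharp_free p n A} \<noteq> {}"
proof -
  have "finite (card ` Pow (Fp_vectors p n))"
    by (simp add: finite_Fp_vectors)
  then show "finite {card A | A. A \<subseteq> Fp_vectors p n \<and> W_sharp_free p n A}"
    by (rule rev_finite_subset) auto
  have "W_sharp_free p n {}"
    by (simp add: W_sharp_free_def)
  then show "{card A | A. A \<subseteq> Fp_vectors p n \<and> W_sharp_free p n A} \<noteq> {}"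
    by blast
qed

end

theory Submission
  imports Defs
begin

text \<open>A solution of the system is a progression \<open>x, x + d, x + 2d\<close> (the variables 1, 3, 5) together
  with a pair \<open>y, y + d\<close> (the variables 2, 4). A progression-free set is therefore admissible, and
  Behrend's spheres give the lower bound.

  For the upper bound, let \<open>A\<close> be admissible and \<open>m = n div 2\<close>. Two progressions in \<open>A\<close> with the same
  difference overlap, so for every \<open>d\<close> at most six points of \<open>A\<close> start a progression with
  difference \<open>d\<close>. Discarding the points that start one whose difference is supported on the first
  \<open>m\<close> coordinates costs at most \<open>6 * p ^ m\<close> points, and the rest of \<open>A\<close> is progression-free inside
  each of the \<open>p ^ (n - m)\<close> cosets of the subspace of vectors supported there. In every coset the
  Ellenberg--Gijswijt bound \<open>3 * (91/96 * p) ^ m\<close> applies, so that altogether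
  \<open>card A \<le> 9 * (91/96) ^ m * p ^ n\<close>.\<close>

subsection \<open>The slice rank bound\<close>

lemma mod_eq_imp_eq_on_PiE:
  assumes "g \<in> A \<rightarrow>\<^sub>E {0..<m}" "g' \<in> A \<rightarrow>\<^sub>E {0..<m}" "\<And>a. a \<in> A \<Longrightarrow> [g a = g' a] (mod (m::int))"
  shows "g = g'"
proof (rule PiE_ext[OF assms(1,2)])
  fix a assume "a \<in> A"
  with assms show "g a = g' a"
    by (intro cong_less_imp_eq_int[of _ m]) (auto simp: PiE_iff)
qed

lemma restrict_mod_eqD:
  fixes f g :: "'j \<Rightarrow> int"
  assumes "(\<lambda>j\<in>J. f j mod m) = (\<lambda>j\<in>J. g j mod m)" "j \<in> J"
  shows "[f j = g j] (mod m)"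
  using fun_cong[OF assms(1), of j] assms(2) by (simp add: cong_def)

text \<open>Over the field with \<open>p\<close> elements, take a common zero \<open>h\<close> of
  maximal support \<open>S\<close>. A nonzero common zero vanishing on \<open>S\<close> could be
  added to \<open>h\<close> and would enlarge the support. Hence a function on \<open>A\<close> is
  determined by the values of the forms together with its restriction to \<open>S\<close>, and
  counting gives the inequality.\<close>

lemma linear_forms_common_zero_large_support:
  fixes p :: nat and c :: "'j \<Rightarrow> 'a \<Rightarrow> int"
  assumes p: "p > 1" and A: "finite A" and J: "finite J"
  obtains h :: "'a \<Rightarrow> int" where
    "\<And>j. j \<in> J \<Longrightarrow> [(\<Sum>a\<in>A. c j a * h a) = 0] (mod int p)"
    "card A \<le> card {a\<in>A. \<not> int p dvd h a} + card J"
proof -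
  define X where "X = A \<rightarrow>\<^sub>E {0..<int p}"
  define K where "K = {h \<in> X. \<forall>j\<in>J. [(\<Sum>a\<in>A. c j a * h a) = 0] (mod int p)}"
  define supp where "supp h = {a\<in>A. \<not> int p dvd h a}" for h :: "'a \<Rightarrow> int"
  have finX: "finite X" unfolding X_def using A by (intro finite_PiE) auto
  have "(\<lambda>a\<in>A. 0) \<in> K" using p by (auto simp: K_def X_def)
  moreover have "card (supp g) \<le> card A" for g unfolding supp_def using A by (intro card_mono) auto
  ultimately obtain h where h: "h \<in> K" and hmax: "\<And>g. g \<in> K \<Longrightarrow> card (supp g) \<le> card (supp h)"
    using ex_has_greatest_nat[of "\<lambda>h. h \<in> K" "\<lambda>a\<in>A. 0" "\<lambda>h. card (supp h)" "Suc (card A)"]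
    by (metis less_Suc_eq_le)
  define S where "S = supp h"
  have finS: "finite S" and SA: "S \<subseteq> A" using A by (auto simp: S_def supp_def)
  define \<Phi> where "\<Phi> g = ((\<lambda>j\<in>J. (\<Sum>a\<in>A. c j a * g a) mod int p), restrict g S)" for g
  define Y where "Y = (J \<rightarrow>\<^sub>E {0..<int p}) \<times> (S \<rightarrow>\<^sub>E {0..<int p})"
  have "inj_on \<Phi> X"
  proof (rule inj_onI)
    fix g g' assume g: "g \<in> X" "g' \<in> X" and eq: "\<Phi> g = \<Phi> g'"
    have "restrict g S = restrict g' S" using eq by (simp add: \<Phi>_def)
    then have eqS: "g a = g' a" if "a \<in> S" for a
      using that by (metis restrict_apply')
    have eqJ: "[(\<Sum>a\<in>A. c j a * g a) = (\<Sum>a\<in>A. c j a * g' a)] (mod int p)" if "j \<in> J" for j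
      using eq that by (intro restrict_mod_eqD[where J = J]) (auto simp: \<Phi>_def)
    \<comment> \<open>\<open>h\<close> shifted by the difference, reduced mod \<open>p\<close> to
      stay in \<open>X\<close>. Since \<open>g\<close> and \<open>g'\<close> agree on
      \<open>S\<close>, the support of \<open>f\<close> contains \<open>S\<close>; maximality makes
      it equal to \<open>S\<close>, so the difference vanishes off \<open>S\<close> too.\<close>
    define f where "f = (\<lambda>a\<in>A. (h a + (g a - g' a)) mod int p)"
    have fK: "f \<in> K"
    proof -
      have "[(\<Sum>a\<in>A. c j a * f a) = 0] (mod int p)" if "j \<in> J" for j
      proof -
        have "[(\<Sum>a\<in>A. c j a * f a) = (\<Sum>a\<in>A. c j a * (h a + (g a - g' a)))] (mod int p)"
          by (intro cong_sum cong_mult) (auto simp: f_def)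
        also have "(\<Sum>a\<in>A. c j a * (h a + (g a - g' a)))
            = (\<Sum>a\<in>A. c j a * h a) + ((\<Sum>a\<in>A. c j a * g a) - (\<Sum>a\<in>A. c j a * g' a))"
          by (simp add: algebra_simps sum.distrib sum_subtractf)
        also have "[\<dots> = 0 + 0] (mod int p)"
          using h that eqJ[OF that] by (intro cong_add) (auto simp: K_def cong_diff_iff_cong_0)
        finally show ?thesis by simp
      qed
      then show ?thesis using p by (auto simp: K_def X_def f_def)
    qed
    have f_dvd: "int p dvd f a \<longleftrightarrow> int p dvd h a + (g a - g' a)" if "a \<in> A" for a
      using that by (simp add: f_def dvd_mod_iff)
    have "S \<subseteq> supp f"
      using eqS SA f_dvd by (auto simp: supp_def S_def)
    moreover have "finite (supp f)" using A by (simp add: supp_def)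
    ultimately have "supp f = S"
      using hmax[OF fK] by (metis S_def card_subset_eq card_mono le_antisym)
    then have "[g a = g' a] (mod int p)" if "a \<in> A" for a
    proof (cases "a \<in> S")
      case False
      then have "int p dvd h a" "int p dvd f a"
        using that \<open>supp f = S\<close> by (auto simp: S_def supp_def)
      then show ?thesis
        using f_dvd[OF that] by (simp add: cong_iff_dvd_diff dvd_add_right_iff)
    qed (use eqS in auto)
    with g show "g = g'" unfolding X_def by (intro mod_eq_imp_eq_on_PiE[of g A "int p" g'])
  qed
  moreover have "\<Phi> ` X \<subseteq> Y"
    using p SA by (auto simp: \<Phi>_def Y_def X_def PiE_iff)
  moreover have "finite Y"
    using J finS by (auto simp: Y_def intro!: finite_PiE)
  ultimately have "card X \<le> card Y" by (metis card_inj_on_le)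
  then have "p ^ card A \<le> p ^ (card J + card S)"
    using A J finS by (simp add: X_def Y_def card_PiE card_cartesian_product power_add)
  then have "card A \<le> card J + card S" by (rule power_le_imp_le_exp[OF p])
  with that[of h] h show ?thesis by (auto simp: K_def S_def supp_def)
qed

text \<open>The slice rank bound of Tao for a diagonal tensor. In place of matrix ranks, the images of
  linear maps over the field with \<open>p\<close> elements are counted.\<close>

lemma card_le_slice_rank:
  fixes p :: nat and A :: "'a set" and J :: "'j set"
    and u v w :: "'j \<Rightarrow> 'a \<Rightarrow> int" and f g h :: "'j \<Rightarrow> 'a \<Rightarrow> 'a \<Rightarrow> int"
  assumes p: "prime p" and A: "finite A" and J: "finite J"
    and T: "\<And>x y z. x \<in> A \<Longrightarrow> y \<in> A \<Longrightarrow> z \<in> A \<Longrightarrow>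
      [(\<Sum>j\<in>J. u j x * f j y z) + (\<Sum>j\<in>J. v j y * g j x z) + (\<Sum>j\<in>J. w j z * h j x y)
        = of_bool (x = y \<and> y = z)] (mod int p)"
  shows "card A \<le> 3 * card J"
proof -
  have p1: "p > 1" using p by (rule prime_gt_1_nat)
  \<comment> \<open>Contracting the third argument with \<open>\<eta>\<close> kills the
    \<open>w\<close> slices and turns the tensor into a diagonal matrix. Its nonzero diagonal
    entries are those indexed by \<open>S\<close>, while the other slices bound its rank by
    \<open>2 * card J\<close>.\<close>
  obtain \<eta> where eta: "\<And>j. j \<in> J \<Longrightarrow> [(\<Sum>a\<in>A. w j a * \<eta> a) = 0] (mod int p)"
    and card_eta: "card A \<le> card {a\<in>A. \<not> int p dvd \<eta> a} + card J"
    using linear_forms_common_zero_large_support[OF p1 A J, of w] by blast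
  define S where "S = {a\<in>A. \<not> int p dvd \<eta> a}"
  have finS: "finite S" and SA: "S \<subseteq> A" using A by (auto simp: S_def)
  define F where "F j y = (\<Sum>z\<in>A. \<eta> z * f j y z)" for j y
  define G where "G j x = (\<Sum>z\<in>A. \<eta> z * g j x z)" for j x
  have matrix: "[(\<Sum>j\<in>J. u j x * F j y) + (\<Sum>j\<in>J. v j y * G j x) = of_bool (x = y) * \<eta> x] (mod int p)"
    if xy: "x \<in> A" "y \<in> A" for x y
  proof -
    have "of_bool (x = y) * \<eta> x = (\<Sum>z\<in>A. \<eta> z * of_bool (x = y \<and> y = z))"
      using A xy by (auto simp: of_bool_def if_distrib cong: if_cong)
    also have "[\<dots> = (\<Sum>z\<in>A. \<eta> z *
        ((\<Sum>j\<in>J. u j x * f j y z) + (\<Sum>j\<in>J. v j y * g j x z) + (\<Sum>j\<in>J. w j z * h j x y)))] (mod int p)"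
      using xy by (intro cong_sum cong_mult cong_sym[OF T]) auto
    also have "(\<Sum>z\<in>A. \<eta> z *
        ((\<Sum>j\<in>J. u j x * f j y z) + (\<Sum>j\<in>J. v j y * g j x z) + (\<Sum>j\<in>J. w j z * h j x y)))
      = (\<Sum>j\<in>J. u j x * F j y) + (\<Sum>j\<in>J. v j y * G j x) + (\<Sum>j\<in>J. h j x y * (\<Sum>z\<in>A. w j z * \<eta> z))"
    proof -
      have *: "(\<Sum>z\<in>A. \<eta> z * (\<Sum>j\<in>J. a j * b j z)) = (\<Sum>j\<in>J. a j * (\<Sum>z\<in>A. \<eta> z * b j z))"
        for a :: "'j \<Rightarrow> int" and b
        unfolding sum_distrib_left by (subst sum.swap) (simp add: mult_ac)
      have **: "(\<Sum>z\<in>A. \<eta> z * (\<Sum>j\<in>J. w j z * h j x y)) = (\<Sum>j\<in>J. h j x y * (\<Sum>z\<in>A. w j z * \<eta> z))"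
        unfolding sum_distrib_left by (subst sum.swap) (simp add: mult_ac)
      show ?thesis
        unfolding F_def G_def by (simp add: distrib_left sum.distrib * **)
    qed
    also have "[\<dots> = (\<Sum>j\<in>J. u j x * F j y) + (\<Sum>j\<in>J. v j y * G j x) + (\<Sum>j\<in>J. h j x y * 0)] (mod int p)"
      using eta by (intro cong_add cong_sum cong_mult) auto
    finally show ?thesis
      unfolding mult_zero_right sum.neutral_const add_0_right by (rule cong_sym)
  qed
  \<comment> \<open>On vectors over \<open>S\<close> the contracted matrix factors through these
    \<open>2 * card J\<close> residues. They determine \<open>\<eta> x * q x\<close>, hence
    \<open>q x\<close>, because \<open>\<eta> x\<close> is invertible mod \<open>p\<close> on
    \<open>S\<close>.\<close>
  define \<Phi> where "\<Phi> q = ((\<lambda>j\<in>J. (\<Sum>y\<in>S. F j y * q y) mod int p), (\<lambda>j\<in>J. (\<Sum>y\<in>S. v j y * q y) mod int p))"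
    for q :: "'a \<Rightarrow> int"
  define Y where "Y = (J \<rightarrow>\<^sub>E {0..<int p}) \<times> (J \<rightarrow>\<^sub>E {0..<int p})"
  have recover: "[\<eta> x * q x = (\<Sum>j\<in>J. u j x * (\<Sum>y\<in>S. F j y * q y)) + (\<Sum>j\<in>J. G j x * (\<Sum>y\<in>S. v j y * q y))] (mod int p)"
    if x: "x \<in> S" for x q
  proof -
    have "\<eta> x * q x = (\<Sum>y\<in>S. if y = x then \<eta> x * q y else 0)"
      using finS x by simp
    also have "\<dots> = (\<Sum>y\<in>S. of_bool (x = y) * \<eta> x * q y)"
      by (intro sum.cong) auto
    also have "[\<dots> = (\<Sum>y\<in>S. ((\<Sum>j\<in>J. u j x * F j y) + (\<Sum>j\<in>J. v j y * G j x)) * q y)] (mod int p)"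
      using SA x by (intro cong_sum cong_mult cong_sym[OF matrix]) auto
    also have "(\<Sum>y\<in>S. ((\<Sum>j\<in>J. u j x * F j y) + (\<Sum>j\<in>J. v j y * G j x)) * q y)
       = (\<Sum>j\<in>J. u j x * (\<Sum>y\<in>S. F j y * q y)) + (\<Sum>j\<in>J. G j x * (\<Sum>y\<in>S. v j y * q y))"
      unfolding distrib_right sum.distrib sum_distrib_left sum_distrib_right
      by (intro arg_cong2[where f = "(+)"]; subst sum.swap) (simp_all add: mult_ac)
    finally show ?thesis .
  qed
  have "inj_on \<Phi> (S \<rightarrow>\<^sub>E {0..<int p})"
  proof (rule inj_onI)
    fix q q' assume q: "q \<in> S \<rightarrow>\<^sub>E {0..<int p}" "q' \<in> S \<rightarrow>\<^sub>E {0..<int p}" and eq: "\<Phi> q = \<Phi> q'"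
    have eqF: "[(\<Sum>y\<in>S. F j y * q y) = (\<Sum>y\<in>S. F j y * q' y)] (mod int p)"
      and eqv: "[(\<Sum>y\<in>S. v j y * q y) = (\<Sum>y\<in>S. v j y * q' y)] (mod int p)" if "j \<in> J" for j
      using eq that by (auto simp: \<Phi>_def intro: restrict_mod_eqD[where J = J])
    have "[q x = q' x] (mod int p)" if x: "x \<in> S" for x
    proof -
      have "[(\<Sum>j\<in>J. u j x * (\<Sum>y\<in>S. F j y * q y)) + (\<Sum>j\<in>J. G j x * (\<Sum>y\<in>S. v j y * q y))
        = (\<Sum>j\<in>J. u j x * (\<Sum>y\<in>S. F j y * q' y)) + (\<Sum>j\<in>J. G j x * (\<Sum>y\<in>S. v j y * q' y))] (mod int p)"
        using eqF eqv by (intro cong_add; intro cong_sum; intro cong_mult cong_refl; blast)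
      with recover[OF x] have "[\<eta> x * q x = \<eta> x * q' x] (mod int p)"
        by (meson cong_sym cong_trans)
      moreover have "coprime (\<eta> x) (int p)"
        using x p by (metis (mono_tags, lifting) S_def coprime_commute mem_Collect_eq prime_imp_coprime prime_nat_int_transfer)
      ultimately show ?thesis by (simp add: cong_mult_lcancel)
    qed
    with q show "q = q'" by (rule mod_eq_imp_eq_on_PiE)
  qed
  moreover have "\<Phi> ` (S \<rightarrow>\<^sub>E {0..<int p}) \<subseteq> Y"
    using p1 by (auto simp: \<Phi>_def Y_def PiE_iff)
  moreover have "finite Y"
    using J by (auto simp: Y_def intro!: finite_PiE)
  ultimately have "card (S \<rightarrow>\<^sub>E {0..<int p}) \<le> card Y" by (metis card_inj_on_le)
  then have "p ^ card S \<le> p ^ (card J + card J)"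
    using finS J by (simp add: Y_def card_PiE card_cartesian_product power_add)
  then have "card S \<le> card J + card J" by (rule power_le_imp_le_exp[OF p1])
  with card_eta show ?thesis by (simp add: S_def)
qed

subsection \<open>Sets without three-term progressions\<close>

lemma fermat_indicator:
  assumes p: "prime p"
  shows "[1 - w ^ (p - 1) = of_bool (int p dvd w)] (mod int p)"
proof (cases "int p dvd w")
  case True
  moreover have "p - 1 > 0" using prime_gt_1_nat[OF p] by simp
  ultimately have "int p dvd w ^ (p - 1)" by (meson dvd_power dvd_trans)
  with True show ?thesis by (simp add: cong_iff_dvd_diff)
next
  case False
  define a where "a = nat (w mod int p)"
  have "int p > 0" using p by (simp add: prime_gt_0_nat)
  then have a: "[w = int a] (mod int p)" by (simp add: a_def cong_def)
  with False have "\<not> p dvd a" by (metis cong_dvd_iff cong_sym int_dvd_int_iff cong_def dvd_eq_mod_eq_0)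
  then have "[int a ^ (p - 1) = 1] (mod int p)"
    using fermat_theorem[OF p, of a] by (metis cong_int_iff of_nat_1 of_nat_power)
  with a have "[w ^ (p - 1) = 1] (mod int p)" by (meson cong_pow cong_trans)
  with False show ?thesis by (simp add: cong_iff_dvd_diff dvd_diff_commute)
qed

text \<open>Separates the variables in one coordinate of the progression indicator. The binomial
  theorem applied twice gives terms of degree exactly \<open>k\<close>; the constant 1 contributes
  the zero exponent.\<close>

lemma trinomial_expansion:
  fixes k :: nat
  obtains D :: "(nat \<times> nat \<times> nat) set" and c :: "nat \<times> nat \<times> nat \<Rightarrow> int"
  where "finite D" "\<And>a b d. (a, b, d) \<in> D \<Longrightarrow> a + b + d \<le> k"
    "\<And>x y z. 1 - (x - 2 * y + z) ^ k = (\<Sum>(a, b, d)\<in>D. c (a, b, d) * x ^ a * y ^ b * z ^ d)"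
proof -
  define D where "D = {t::nat \<times> nat \<times> nat. fst t + fst (snd t) + snd (snd t) \<le> k}"
  define E where "E = {t::nat \<times> nat \<times> nat. fst t + fst (snd t) + snd (snd t) = k}"
  define e :: "nat \<times> nat \<times> nat \<Rightarrow> int" where
    "e = (\<lambda>(a, b, d). of_nat (k choose a) * of_nat ((k - a) choose b) * (- 2) ^ b)"
  have "D \<subseteq> {..k} \<times> {..k} \<times> {..k}" by (auto simp: D_def)
  then have finD: "finite D" by (rule finite_subset) auto
  have ED: "E \<subseteq> D" by (auto simp: E_def D_def)
  have pow: "(x - 2 * y + z) ^ k = (\<Sum>(a, b, d)\<in>E. e (a, b, d) * x ^ a * y ^ b * z ^ d)" for x y z :: int
  proof -
    have "(x - 2 * y + z) ^ k = (x + ((- 2 * y) + z)) ^ k" by (simp add: algebra_simps)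
    also have "\<dots> = (\<Sum>a\<le>k. \<Sum>b\<le>k - a. e (a, b, k - a - b) * x ^ a * y ^ b * z ^ (k - a - b))"
      unfolding binomial_ring e_def sum_distrib_left power_mult_distrib prod.case
      by (intro sum.cong refl) (simp only: mult_ac)
    also have "\<dots> = (\<Sum>(a, b)\<in>(SIGMA a:{..k}. {..k - a}). e (a, b, k - a - b) * x ^ a * y ^ b * z ^ (k - a - b))"
      by (subst sum.Sigma) auto
    also have "\<dots> = (\<Sum>(a, b, d)\<in>E. e (a, b, d) * x ^ a * y ^ b * z ^ d)"
      by (rule sum.reindex_bij_witness[where j = "\<lambda>(a, b). (a, b, k - a - b)" and i = "\<lambda>(a, b, d). (a, b)"])
        (auto simp: E_def)
    finally show ?thesis .
  qed
  \<comment> \<open>For \<open>k = 0\<close> the zero exponent also lies in \<open>E\<close>, so the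
    two contributions are added instead of being separated by cases.\<close>
  define c where "c t = of_bool (t = (0, 0, 0)) - of_bool (t \<in> E) * e t" for t
  have "1 - (x - 2 * y + z) ^ k = (\<Sum>(a, b, d)\<in>D. c (a, b, d) * x ^ a * y ^ b * z ^ d)" for x y z :: int
  proof -
    define m where "m = (\<lambda>(a, b, d). x ^ a * y ^ b * z ^ d)"
    have "(\<Sum>t\<in>D. of_bool (t = (0, 0, 0)) * m t) = m (0, 0, 0)"
      using sum.mono_neutral_cong_right[OF finD, of "{(0, 0, 0)}" "\<lambda>t. of_bool (t = (0, 0, 0)) * m t" m]
      by (auto simp: D_def)
    moreover have "(\<Sum>t\<in>D. of_bool (t \<in> E) * e t * m t) = (\<Sum>t\<in>E. e t * m t)"
      using finD ED by (intro sum.mono_neutral_cong_right) auto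
    ultimately have "(\<Sum>t\<in>D. c t * m t) = 1 - (\<Sum>t\<in>E. e t * m t)"
      by (simp add: c_def left_diff_distrib sum_subtractf m_def)
    moreover have "(\<Sum>(a, b, d)\<in>S. f (a, b, d) * x ^ a * y ^ b * z ^ d) = (\<Sum>t\<in>S. f t * m t)" for f S
      by (intro sum.cong refl) (auto simp: m_def mult.assoc)
    ultimately show ?thesis unfolding pow by simp
  qed
  moreover have "a + b + d \<le> k" if "(a, b, d) \<in> D" for a b d using that by (simp add: D_def)
  ultimately show thesis using finD by (intro that[of D c])
qed

text \<open>The progression tensor has total degree \<open>card I * (p - 1)\<close>, so each of its monomials has degree
  at most a third of this in one of its three vector arguments.\<close>

definition low_monomials :: "nat \<Rightarrow> 'i set \<Rightarrow> ('i \<Rightarrow> nat) set" where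
  "low_monomials p I = {\<alpha> \<in> I \<rightarrow>\<^sub>E {..<p}. 3 * (\<Sum>i\<in>I. \<alpha> i) \<le> card I * (p - 1)}"

lemma finite_low_monomials: "finite I \<Longrightarrow> finite (low_monomials p I)"
  by (auto simp: low_monomials_def intro!: finite_PiE)

text \<open>Brings a sum into slice form: terms with the same monomial in \<open>X\<close> are
  collected, and \<open>r\<close> carries the factors that depend on the other two
  arguments.\<close>

lemma sum_by_exponents:
  assumes "finite Q" "finite J" "\<And>q. q \<in> Q \<Longrightarrow> restrict (e q) I \<in> J"
  shows "(\<Sum>q\<in>Q. (\<Prod>i\<in>I. X i ^ e q i) * r q) =
    (\<Sum>\<alpha>\<in>J. (\<Prod>i\<in>I. X i ^ \<alpha> i) * (\<Sum>q | q \<in> Q \<and> restrict (e q) I = \<alpha>. r q :: int))"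
proof -
  have "(\<Sum>q\<in>Q. (\<Prod>i\<in>I. X i ^ e q i) * r q) =
    (\<Sum>\<alpha>\<in>J. \<Sum>q | q \<in> Q \<and> restrict (e q) I = \<alpha>. (\<Prod>i\<in>I. X i ^ e q i) * r q)"
    by (rule sum.group[symmetric]) (use assms in auto)
  also have "\<dots> = (\<Sum>\<alpha>\<in>J. (\<Prod>i\<in>I. X i ^ \<alpha> i) * (\<Sum>q | q \<in> Q \<and> restrict (e q) I = \<alpha>. r q))"
    unfolding sum_distrib_left by (intro sum.cong refl) (auto intro!: prod.cong arg_cong2[where f = "(*)"])
  finally show ?thesis .
qed

text \<open>The Ellenberg--Gijswijt argument in Tao's form. By Fermat's little theorem the product
  of \<open>1 - (x i - 2 * y i + z i) ^ (p - 1)\<close> over \<open>I\<close> is the indicator of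
  progressions, which is diagonal on \<open>A\<close>; its monomials split into slices indexed by
  low monomials. The elements of \<open>A\<close> may have coordinates outside \<open>I\<close>,
  which allows an application to cosets.\<close>

lemma card_progression_free_le_low_monomials:
  fixes A :: "('i \<Rightarrow> int) set"
  assumes p: "prime p" and I: "finite I" and A: "finite A"
    and free: "\<And>x y z. x \<in> A \<Longrightarrow> y \<in> A \<Longrightarrow> z \<in> A \<Longrightarrow>
      (\<And>i. i \<in> I \<Longrightarrow> int p dvd x i - 2 * y i + z i) \<Longrightarrow> x = y \<and> y = z"
  shows "card A \<le> 3 * card (low_monomials p I)"
proof -
  obtain D c where D: "finite D" "\<And>a b d. (a, b, d) \<in> D \<Longrightarrow> a + b + d \<le> p - 1"
    and c: "\<And>x y z. 1 - (x - 2 * y + z) ^ (p - 1) = (\<Sum>(a, b, d)\<in>D. c (a, b, d) * x ^ a * y ^ b * z ^ d :: int)"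
    by (rule trinomial_expansion[of "p - 1"]) (rule that)
  define J where "J = low_monomials p I"
  have finJ: "finite J" using I by (simp add: J_def finite_low_monomials)
  \<comment> \<open>An element of \<open>P\<close> picks one exponent triple per coordinate, hence
    one term of the expanded product.\<close>
  define P where "P = (I \<rightarrow>\<^sub>E D)"
  have finP: "finite P" using I D by (auto simp: P_def intro!: finite_PiE)
  define e1 where "e1 q i = fst (q i)" for q :: "'i \<Rightarrow> nat \<times> nat \<times> nat" and i
  define e2 where "e2 q i = fst (snd (q i))" for q :: "'i \<Rightarrow> nat \<times> nat \<times> nat" and i
  define e3 where "e3 q i = snd (snd (q i))" for q :: "'i \<Rightarrow> nat \<times> nat \<times> nat" and i
  define C where "C q = (\<Prod>i\<in>I. c (q i))" for q
  define mon where "mon x \<alpha> = (\<Prod>i\<in>I. x i ^ \<alpha> i)" for x :: "'i \<Rightarrow> int" and \<alpha>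
  \<comment> \<open>Each term goes to the first of its three arguments in which its degree is
    low.\<close>
  define P1 where "P1 = {q \<in> P. restrict (e1 q) I \<in> J}"
  define P2 where "P2 = {q \<in> P - P1. restrict (e2 q) I \<in> J}"
  define P3 where "P3 = P - P1 - P2"
  have deg: "e1 q i + e2 q i + e3 q i \<le> p - 1" if "q \<in> P" "i \<in> I" for q i
    using D(2)[of "e1 q i" "e2 q i" "e3 q i"] that by (auto simp: e1_def e2_def e3_def P_def)
  have in_J: "restrict e I \<in> J" if "3 * (\<Sum>i\<in>I. e i) \<le> card I * (p - 1)" "\<And>i. i \<in> I \<Longrightarrow> e i \<le> p - 1" for e
    using that prime_gt_1_nat[OF p] by (fastforce simp: J_def low_monomials_def)
  have P3: "restrict (e3 q) I \<in> J" if "q \<in> P3" for q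
  proof (rule in_J)
    have qP: "q \<in> P" and n1: "restrict (e1 q) I \<notin> J" and n2: "restrict (e2 q) I \<notin> J"
      using that by (auto simp: P3_def P2_def P1_def)
    \<comment> \<open>If the first two degrees both exceed a third of the total bound, less than a
      third is left for the last.\<close>
    have *: "3 * (\<Sum>i\<in>I. e1 q i) > card I * (p - 1)" "3 * (\<Sum>i\<in>I. e2 q i) > card I * (p - 1)"
      using in_J[of "e1 q"] in_J[of "e2 q"] n1 n2 deg[OF qP] by (meson not_le add_leE)+
    have "(\<Sum>i\<in>I. e1 q i) + (\<Sum>i\<in>I. e2 q i) + (\<Sum>i\<in>I. e3 q i) \<le> (\<Sum>i\<in>I. p - 1)"
      unfolding sum.distrib[symmetric] using deg[OF qP] by (rule sum_mono)
    with * show "3 * (\<Sum>i\<in>I. e3 q i) \<le> card I * (p - 1)" by simp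
    show "\<And>i. i \<in> I \<Longrightarrow> e3 q i \<le> p - 1" using deg[OF qP] by (meson add_leE)
  qed
  define f where "f \<alpha> y z = (\<Sum>q | q \<in> P1 \<and> restrict (e1 q) I = \<alpha>. C q * mon y (e2 q) * mon z (e3 q))" for \<alpha> y z
  define g where "g \<alpha> x z = (\<Sum>q | q \<in> P2 \<and> restrict (e2 q) I = \<alpha>. C q * mon x (e1 q) * mon z (e3 q))" for \<alpha> x z
  define h where "h \<alpha> x y = (\<Sum>q | q \<in> P3 \<and> restrict (e3 q) I = \<alpha>. C q * mon x (e1 q) * mon y (e2 q))" for \<alpha> x y
  have expand: "(\<Prod>i\<in>I. 1 - (x i - 2 * y i + z i) ^ (p - 1)) =
      (\<Sum>\<alpha>\<in>J. mon x \<alpha> * f \<alpha> y z) + (\<Sum>\<alpha>\<in>J. mon y \<alpha> * g \<alpha> x z) + (\<Sum>\<alpha>\<in>J. mon z \<alpha> * h \<alpha> x y)" for x y z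
  proof -
    define R where "R q = C q * mon x (e1 q) * mon y (e2 q) * mon z (e3 q)" for q
    have "(\<Prod>i\<in>I. 1 - (x i - 2 * y i + z i) ^ (p - 1)) = (\<Sum>q\<in>P. R q)"
      unfolding c P_def using I D(1)
      by (subst prod_sum_PiE) (simp_all add: case_prod_unfold R_def C_def mon_def e1_def e2_def e3_def prod.distrib)
    also have "\<dots> = (\<Sum>q\<in>P1. R q) + (\<Sum>q\<in>P2. R q) + (\<Sum>q\<in>P3. R q)"
    proof -
      have "P = P1 \<union> P2 \<union> P3" "P1 \<inter> P2 = {}" "(P1 \<union> P2) \<inter> P3 = {}" "finite P1" "finite P2" "finite P3"
        using finP by (auto simp: P1_def P2_def P3_def)
      then show ?thesis by (simp add: sum.union_disjoint)
    qed
    also have "(\<Sum>q\<in>P1. R q) = (\<Sum>q\<in>P1. mon x (e1 q) * (C q * mon y (e2 q) * mon z (e3 q)))"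
      by (simp add: R_def mult_ac)
    also have "\<dots> = (\<Sum>\<alpha>\<in>J. mon x \<alpha> * f \<alpha> y z)"
      unfolding f_def mon_def[of x] by (rule sum_by_exponents) (use finP finJ in \<open>auto simp: P1_def\<close>)
    also have "(\<Sum>q\<in>P2. R q) = (\<Sum>q\<in>P2. mon y (e2 q) * (C q * mon x (e1 q) * mon z (e3 q)))"
      by (simp add: R_def mult_ac)
    also have "\<dots> = (\<Sum>\<alpha>\<in>J. mon y \<alpha> * g \<alpha> x z)"
      unfolding g_def mon_def[of y] by (rule sum_by_exponents) (use finP finJ in \<open>auto simp: P2_def\<close>)
    also have "(\<Sum>q\<in>P3. R q) = (\<Sum>q\<in>P3. mon z (e3 q) * (C q * mon x (e1 q) * mon y (e2 q)))"
      by (simp add: R_def mult_ac)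
    also have "\<dots> = (\<Sum>\<alpha>\<in>J. mon z \<alpha> * h \<alpha> x y)"
      unfolding h_def mon_def[of z] by (rule sum_by_exponents) (use finP finJ P3 in \<open>auto simp: P3_def\<close>)
    finally show ?thesis .
  qed
  have tensor: "[(\<Prod>i\<in>I. 1 - (x i - 2 * y i + z i) ^ (p - 1)) = of_bool (x = y \<and> y = z)] (mod int p)"
    if xyz: "x \<in> A" "y \<in> A" "z \<in> A" for x y z
  proof -
    have "[(\<Prod>i\<in>I. 1 - (x i - 2 * y i + z i) ^ (p - 1)) = (\<Prod>i\<in>I. of_bool (int p dvd x i - 2 * y i + z i))] (mod int p)"
      by (intro cong_prod fermat_indicator p)
    also have "(\<Prod>i\<in>I. of_bool (int p dvd x i - 2 * y i + z i)) = (of_bool (\<forall>i\<in>I. int p dvd x i - 2 * y i + z i) :: int)"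
      using I by (induction I) auto
    also have "(\<forall>i\<in>I. int p dvd x i - 2 * y i + z i) \<longleftrightarrow> x = y \<and> y = z"
      using free[OF xyz] by auto
    finally show ?thesis .
  qed
  show ?thesis
    unfolding J_def[symmetric]
    by (rule card_le_slice_rank[OF p A finJ, where u = "\<lambda>\<alpha> x. mon x \<alpha>" and v = "\<lambda>\<alpha> x. mon x \<alpha>"
        and w = "\<lambda>\<alpha> x. mon x \<alpha>" and f = f and g = g and h = h])
      (use tensor in \<open>simp only: expand\<close>)
qed

section \<open>Counting the monomials of low degree\<close>

text \<open>Pair each term with its mirror image. Two numbers \<open>u\<close>, \<open>v\<close> in
  the unit interval satisfy \<open>(1 - u) * (1 - v) \<ge> 0\<close>, that is
  \<open>u + v \<le> 1 + u * v\<close>, and every pair has product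
  \<open>t ^ (p - 1)\<close>.\<close>

lemma sum_geometric_le:
  fixes t :: real
  assumes t: "0 \<le> t" "t \<le> 1" and p: "p \<ge> 1"
  shows "(\<Sum>a<p. t ^ a) \<le> real p * (1 + t ^ (p - 1)) / 2"
proof -
  have "2 * (\<Sum>a<p. t ^ a) = (\<Sum>a<p. t ^ a) + (\<Sum>a<p. t ^ (p - Suc a))"
    by (simp add: sum.nat_diff_reindex)
  also have "\<dots> = (\<Sum>a<p. t ^ a + t ^ (p - Suc a))" by (simp add: sum.distrib)
  also have "\<dots> \<le> (\<Sum>a<p. 1 + t ^ (p - 1))"
  proof (rule sum_mono)
    fix a assume "a \<in> {..<p}"
    then have "t ^ (p - 1) = t ^ a * t ^ (p - Suc a)" by (simp flip: power_add)
    moreover have "0 \<le> (1 - t ^ a) * (1 - t ^ (p - Suc a))"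
      using t by (intro mult_nonneg_nonneg) (auto intro: power_le_one)
    ultimately show "t ^ a + t ^ (p - Suc a) \<le> 1 + t ^ (p - 1)" by (simp add: algebra_simps)
  qed
  finally show ?thesis by simp
qed

text \<open>Chernoff's method, with the weight \<open>t\<close> per unit of degree chosen so that
  \<open>t ^ (p - 1) = (3/4) ^ 3\<close>.\<close>

lemma card_low_monomials_le:
  assumes p: "p \<ge> 2" and I: "finite I"
  shows "real (card (low_monomials p I)) \<le> (91 / 96 * real p) ^ card I"
proof -
  define t :: real where "t = root (p - 1) (27 / 64)"
  have tp: "t ^ (p - 1) = 27 / 64" and t: "0 < t" "t \<le> 1" using p by (auto simp: t_def)
  \<comment> \<open>Comparing cubes matches the factor 3 in the degree condition without fractional
    exponents.\<close>
  have weight: "(3 / 4) ^ card I \<le> t ^ (\<Sum>i\<in>I. \<alpha> i)" if "\<alpha> \<in> low_monomials p I" for \<alpha>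
  proof -
    have "((3 / 4) ^ card I) ^ 3 = (27 / 64 :: real) ^ card I"
      by (simp flip: power_mult add: mult.commute[of _ 3]) (simp add: power_mult power3_eq_cube)
    also have "\<dots> = t ^ (card I * (p - 1))" by (metis tp mult.commute power_mult)
    also have "\<dots> \<le> t ^ (3 * (\<Sum>i\<in>I. \<alpha> i))"
      using that t by (intro power_decreasing) (auto simp: low_monomials_def)
    also have "\<dots> = (t ^ (\<Sum>i\<in>I. \<alpha> i)) ^ 3" by (simp add: mult.commute[of 3] power_mult)
    finally show ?thesis using t by (simp add: power_mono_iff)
  qed
  have "(3 / 4) ^ card I * real (card (low_monomials p I)) \<le> (\<Sum>\<alpha>\<in>low_monomials p I. t ^ (\<Sum>i\<in>I. \<alpha> i))"
    using sum_mono[OF weight] by (simp add: mult.commute)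
  also have "\<dots> \<le> (\<Sum>\<alpha>\<in>I \<rightarrow>\<^sub>E {..<p}. t ^ (\<Sum>i\<in>I. \<alpha> i))"
    using I t by (intro sum_mono2) (auto simp: low_monomials_def intro!: finite_PiE)
  also have "\<dots> = (\<Sum>a<p. t ^ a) ^ card I"
    using I by (subst prod_constant[symmetric], subst prod_sum_PiE) (auto simp: power_sum)
  also have "\<dots> \<le> (real p * (1 + 27 / 64) / 2) ^ card I"
    using sum_geometric_le[of t p] t p unfolding tp by (intro power_mono sum_nonneg) auto
  \<comment> \<open>\<open>(1 + 27/64) / 2 = 91/128 = 3/4 * 91/96\<close>; the factor
    \<open>3/4\<close> cancels against the weight.\<close>
  also have "\<dots> = (3 / 4) ^ card I * (91 / 96 * real p) ^ card I"
    unfolding power_mult_distrib[symmetric] by (intro arg_cong2[where f = power]) simp_all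
  finally show ?thesis by simp
qed

subsection \<open>The system W\<close>

lemma Fp_vectors_iff: "x \<in> Fp_vectors p n \<longleftrightarrow> x \<in> {..<n} \<rightarrow>\<^sub>E {0..<int p}"
proof -
  have "{0..int p - 1} = {0..<int p}" by auto
  then show ?thesis by (simp add: Fp_vectors_def residue_ring_def)
qed

lemma W_sharp_free_progression_free:
  assumes AP: "\<And>x y z. x \<in> A \<Longrightarrow> y \<in> A \<Longrightarrow> z \<in> A \<Longrightarrow>
    (\<And>i. i < n \<Longrightarrow> [x i - 2 * y i + z i = 0] (mod int p)) \<Longrightarrow> x = z"
  shows "W_sharp_free p n A"
  unfolding W_sharp_free_def
proof (intro notI, elim bexE conjE)
  fix x1 x2 x3 x4 x5
  assume "x1 \<in> A" "x3 \<in> A" "x5 \<in> A" "W_system p n x1 x2 x3 x4 x5" and dist: "distinct [x1, x2, x3, x4, x5]"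
  then have "x1 = x5" by (intro AP[of x1 x3 x5]) (auto simp: W_system_def)
  with dist show False by simp
qed

text \<open>Behrend's construction: with digits at most \<open>(p - 1) / 2\<close> a progression modulo \<open>p\<close> is one over
  the integers, and a sphere contains no three collinear points.\<close>

lemma W_sharp_free_sphere:
  assumes q: "2 * q < p" and A: "A \<subseteq> {..<n} \<rightarrow>\<^sub>E {0..int q}"
    and sphere: "\<And>x. x \<in> A \<Longrightarrow> (\<Sum>i<n. x i ^ 2) = r"
  shows "W_sharp_free p n A"
proof (rule W_sharp_free_progression_free)
  fix x y z assume xyz: "x \<in> A" "y \<in> A" "z \<in> A"
    and AP: "\<And>i. i < n \<Longrightarrow> [x i - 2 * y i + z i = 0] (mod int p)"
  have box: "x i \<in> {0..int q} \<and> y i \<in> {0..int q} \<and> z i \<in> {0..int q}" if "i < n" for i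
    using xyz A that by (auto simp: PiE_iff)
  have sum: "x i + z i = 2 * y i" if "i < n" for i
  \<comment> \<open>Both sides lie between 0 and \<open>2 * q < p\<close>, so there is no
    wrap-around.\<close>
  proof (rule cong_less_imp_eq_int)
    have "x i - 2 * y i + z i = x i + z i - 2 * y i" by simp
    then show "[x i + z i = 2 * y i] (mod int p)"
      using AP[OF that] by (simp add: cong_iff_dvd_diff algebra_simps)
  qed (use box[OF that] q in auto)
  \<comment> \<open>The parallelogram law with \<open>x + z = 2 * y\<close>; on the sphere the right
    side sums to \<open>2 * r + 2 * r - 4 * r = 0\<close>.\<close>
  have "(\<Sum>i<n. (x i - z i) ^ 2) = (\<Sum>i<n. 2 * x i ^ 2 + 2 * z i ^ 2 - 4 * y i ^ 2)"
  proof (rule sum.cong)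
    fix i assume "i \<in> {..<n}"
    then have z: "z i = 2 * y i - x i" using sum[of i] by simp
    show "(x i - z i) ^ 2 = 2 * x i ^ 2 + 2 * z i ^ 2 - 4 * y i ^ 2"
      unfolding z by (simp add: power2_eq_square algebra_simps)
  qed simp
  also have "\<dots> = 0"
    using sphere xyz by (simp add: sum.distrib sum_subtractf flip: sum_distrib_left)
  finally have "x i = z i" if "i < n" for i
    using that by (simp add: sum_nonneg_eq_0_iff)
  then show "x = z" using xyz A by (intro PiE_ext[of x "{..<n}" "\<lambda>_. {0..int q}" z]) auto
qed

section \<open>The extremal number and its lower bound\<close>

lemma ex_W_sharp_ge:
  assumes "A \<subseteq> Fp_vectors p n" "W_sharp_free p n A"
  shows "card A \<le> ex_W_sharp p n"
  unfolding ex_W_sharp_def using assms by (intro Max_ge ex_W_sharp_set) auto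

lemma ex_W_sharp_attained:
  obtains A where "A \<subseteq> Fp_vectors p n" "W_sharp_free p n A" "card A = ex_W_sharp p n"
proof -
  have "ex_W_sharp p n \<in> {card A | A. A \<subseteq> Fp_vectors p n \<and> W_sharp_free p n A}"
    unfolding ex_W_sharp_def by (rule Max_in[OF ex_W_sharp_set])
  then obtain A where "ex_W_sharp p n = card A" "A \<subseteq> Fp_vectors p n" "W_sharp_free p n A"
    unfolding mem_Collect_eq by (elim exE conjE)
  then show thesis by (intro that[of A]) simp_all
qed

text \<open>Pigeonhole: the box of small digits has at least \<open>(p / 2) ^ n\<close> points and
  the squared norm takes at most \<open>n * p ^ 2 + 1\<close> values on it, so some sphere is
  large.\<close>

lemma ex_W_sharp_lower:
  assumes p: "p \<ge> 2"
  shows "(real p / 2) ^ n \<le> real (ex_W_sharp p n) * real (n * p ^ 2 + 1)"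
proof -
  \<comment> \<open>The largest digit bound with \<open>2 * q < p\<close>; rounding down still
    leaves \<open>q + 1 \<ge> p / 2\<close> digits.\<close>
  define q where "q = (p - 1) div 2"
  define X where "X = {..<n} \<rightarrow>\<^sub>E {0..int q}"
  define s where "s x = (\<Sum>i<n. x i ^ 2)" for x :: "nat \<Rightarrow> int"
  define R where "R = {0..int (n * p ^ 2)}"
  have qp: "2 * q < p" and pq: "p \<le> 2 * (q + 1)" using p by (auto simp: q_def)
  have finX: "finite X" unfolding X_def by (intro finite_PiE) auto
  have "s \<in> X \<rightarrow> R"
  proof
    fix x assume x: "x \<in> X"
    have "x i ^ 2 \<le> int p ^ 2" if "i < n" for i
    proof -
      have "x i \<in> {0..int q}" using x that by (simp add: X_def PiE_iff)
      then show ?thesis using qp by (intro power_mono) auto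
    qed
    then have "(\<Sum>i<n. x i ^ 2) \<le> (\<Sum>i<n. int p ^ 2)" by (intro sum_mono) auto
    then show "s x \<in> R" by (auto simp: R_def s_def sum_nonneg)
  qed
  then obtain r where r: "card X \<le> card (s -` {r} \<inter> X) * card R"
    using pigeonhole_card[of s X R] finX by (auto simp: R_def)
  define A where "A = s -` {r} \<inter> X"
  have "W_sharp_free p n A"
    by (rule W_sharp_free_sphere[OF qp]) (simp_all add: A_def X_def s_def subset_iff)
  moreover have "A \<subseteq> Fp_vectors p n"
  proof -
    have "X \<subseteq> {..<n} \<rightarrow>\<^sub>E {0..<int p}" using qp unfolding X_def by (intro PiE_mono) auto
    then show ?thesis by (auto simp: A_def subset_iff Fp_vectors_iff)
  qed
  ultimately have A: "card A \<le> ex_W_sharp p n" by (intro ex_W_sharp_ge)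
  have "(real p / 2) ^ n \<le> real (q + 1) ^ n" using pq by (intro power_mono) auto
  also have "\<dots> = real (card X)" by (simp add: X_def card_PiE add.commute)
  also have "\<dots> \<le> real (card A * card R)" using r by (simp only: A_def of_nat_le_iff)
  also have "\<dots> \<le> real (ex_W_sharp p n * (n * p ^ 2 + 1))"
    unfolding of_nat_le_iff using A by (intro mult_mono) (auto simp: R_def nat_add_distrib nat_mult_distrib nat_power_eq)
  finally show ?thesis by (simp only: of_nat_mult)
qed

section \<open>The upper bound: removing progressions, then slicing into cosets\<close>

text \<open>Fix one progression \<open>E\<close> starting in \<open>F\<close>. If \<open>x\<close>
  and \<open>Y x\<close> both avoided \<open>E\<close>, they would serve as variables 2 and 4 beside
  it and give a forbidden solution. So \<open>x\<close> or \<open>Y x\<close> lies in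
  \<open>E\<close>; as \<open>Y\<close> is translation by the common difference, it is injective,
  and each case accounts for at most three \<open>x\<close>.\<close>

lemma card_common_difference_le:
  fixes A :: "(nat \<Rightarrow> int) set"
  assumes A: "A \<subseteq> Fp_vectors p n" and free: "W_sharp_free p n A"
    and F: "F \<subseteq> A"
    and Y: "\<And>x. x \<in> F \<Longrightarrow> Y x \<in> A \<and> Z x \<in> A \<and> distinct [x, Y x, Z x] \<and>
      (\<forall>i<n. [x i - 2 * Y x i + Z x i = 0] (mod int p))"
    and diff: "\<And>x x' i. x \<in> F \<Longrightarrow> x' \<in> F \<Longrightarrow> i < n \<Longrightarrow> [Y x i - x i = Y x' i - x' i] (mod int p)"
  shows "card F \<le> 6"
proof (cases "F = {}")
  case False
  then obtain x0 where x0: "x0 \<in> F" by auto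
  define E where "E = {x0, Y x0, Z x0}"
  have "inj_on Y F"
  proof (rule inj_onI)
    fix x x' assume x: "x \<in> F" "x' \<in> F" and eq: "Y x = Y x'"
    have "x \<in> {..<n} \<rightarrow>\<^sub>E {0..<int p}" "x' \<in> {..<n} \<rightarrow>\<^sub>E {0..<int p}"
      using x F A by (simp_all add: subset_iff flip: Fp_vectors_iff)
    then show "x = x'"
    proof (rule mod_eq_imp_eq_on_PiE)
      fix i assume "i \<in> {..<n}"
      then show "[x i = x' i] (mod int p)"
        using diff[OF x, of i] eq by (simp add: cong_iff_dvd_diff dvd_diff_commute)
    qed
  qed
  have "x \<in> E \<or> Y x \<in> E" if x: "x \<in> F" for x
  proof (rule ccontr)
    assume "\<not> (x \<in> E \<or> Y x \<in> E)"
    then have "distinct [x0, x, Y x0, Y x, Z x0]"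
      using Y[OF x] Y[OF x0] by (auto simp: E_def)
    moreover have "W_system p n x0 x (Y x0) (Y x) (Z x0)"
    proof -
      have "[x0 i - x i - Y x0 i + Y x i = 0] (mod int p)" if "i < n" for i
      proof -
        have "x0 i - x i - Y x0 i + Y x i = (Y x i - x i) - (Y x0 i - x0 i)" by simp
        then show ?thesis using diff[OF x x0 that] by (simp only: cong_diff_iff_cong_0)
      qed
      then show ?thesis using Y[OF x0] by (auto simp: W_system_def)
    qed
    ultimately show False
      using free Y[OF x] Y[OF x0] x x0 F unfolding W_sharp_free_def by blast
  qed
  then have "F \<subseteq> E \<union> {x \<in> F. Y x \<in> E}" by auto
  moreover have "finite E" by (simp add: E_def)
  moreover have inj: "inj_on Y {x \<in> F. Y x \<in> E}"
    using \<open>inj_on Y F\<close> by (rule inj_on_subset) simp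
  moreover have "finite {x \<in> F. Y x \<in> E}"
    using \<open>finite E\<close> by (intro inj_on_finite[OF inj, of E]) auto
  moreover have "card {x \<in> F. Y x \<in> E} \<le> card E"
    using \<open>finite E\<close> by (intro card_inj_on_le[OF inj]) auto
  moreover have "card E \<le> 3" by (auto simp: E_def card_insert_if)
  ultimately have "card F \<le> card (E \<union> {x \<in> F. Y x \<in> E})" by (intro card_mono) auto
  also have "\<dots> \<le> card E + card {x \<in> F. Y x \<in> E}" by (rule card_Un_le)
  finally show ?thesis
    using \<open>card {x \<in> F. Y x \<in> E} \<le> card E\<close> \<open>card E \<le> 3\<close> by simp
qed simp

lemma card_fibres_le:
  assumes "finite A" "finite B" "f ` A \<subseteq> B" "\<And>b. b \<in> B \<Longrightarrow> card {a\<in>A. f a = b} \<le> k"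
  shows "card A \<le> k * card B"
proof -
  have "card A = (\<Sum>b\<in>B. card {a\<in>A. f a = b})"
    using sum.group[OF assms(1-3), of "\<lambda>_. 1::nat"] by simp
  also have "\<dots> \<le> (\<Sum>b\<in>B. k)" by (intro sum_mono assms)
  finally show ?thesis by (simp add: mult.commute)
qed

lemma card_W_sharp_free_le:
  assumes p: "prime p" and p3: "p \<ge> 3" and m: "m \<le> n"
    and A: "A \<subseteq> Fp_vectors p n" and free: "W_sharp_free p n A"
  shows "card A \<le> 6 * p ^ m + 3 * card (low_monomials p {..<m}) * p ^ (n - m)"
proof -
  \<comment> \<open>Residues are canonical, so agreement of \<open>x\<close> and \<open>y\<close>
    from \<open>m\<close> on says that the common difference is supported on the first
    \<open>m\<close> coordinates.\<close>
  define AP where "AP x y z \<longleftrightarrow> x \<in> A \<and> y \<in> A \<and> z \<in> A \<and> distinct [x, y, z] \<and>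
    (\<forall>i<n. [x i - 2 * y i + z i = 0] (mod int p)) \<and> (\<forall>i\<in>{m..<n}. x i = y i)" for x y z
  define B where "B = {x. \<exists>y z. AP x y z}"
  have finA: "finite A" using A finite_Fp_vectors finite_subset by blast
  have BA: "B \<subseteq> A" by (auto simp: B_def AP_def)
  then have finB: "finite B" using finA finite_subset by blast
  have "\<forall>x\<in>B. \<exists>y z. AP x y z" by (simp add: B_def)
  then obtain Y Z where YZ: "\<And>x. x \<in> B \<Longrightarrow> AP x (Y x) (Z x)" by metis
  \<comment> \<open>These \<open>m\<close> residues determine the whole difference, so there are at
    most \<open>p ^ m\<close> classes.\<close>
  define D where "D x = (\<lambda>i\<in>{..<m}. (Y x i - x i) mod int p)" for x
  have "card B \<le> 6 * card ({..<m} \<rightarrow>\<^sub>E {0..<int p})"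
  proof (rule card_fibres_le[where f = D])
    show "D ` B \<subseteq> {..<m} \<rightarrow>\<^sub>E {0..<int p}" using p3 by (intro image_subsetI) (simp add: D_def)
    fix d
    show "card {x \<in> B. D x = d} \<le> 6"
    proof (rule card_common_difference_le[OF A free, of _ Y Z])
      show "{x \<in> B. D x = d} \<subseteq> A" using BA by auto
      show "Y x \<in> A \<and> Z x \<in> A \<and> distinct [x, Y x, Z x] \<and>
          (\<forall>i<n. [x i - 2 * Y x i + Z x i = 0] (mod int p))" if "x \<in> {x \<in> B. D x = d}" for x
        using YZ[of x] that unfolding AP_def by blast
      show "[Y x i - x i = Y x' i - x' i] (mod int p)"
        if "x \<in> {x \<in> B. D x = d}" "x' \<in> {x \<in> B. D x = d}" "i < n" for x x' i
      proof (cases "i < m")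
        case True
        have "D x = D x'" using that by simp
        with True show ?thesis unfolding D_def by (intro restrict_mod_eqD[where J = "{..<m}"]) auto
      next
        case False
        with that show ?thesis using YZ[of x] YZ[of x'] by (auto simp: AP_def)
      qed
    qed
  qed (use finB in \<open>auto intro!: finite_PiE\<close>)
  then have card_B: "card B \<le> 6 * p ^ m" by (simp add: card_PiE)
  \<comment> \<open>Fixing the last \<open>n - m\<close> coordinates cuts \<open>A - B\<close> into
    cosets.\<close>
  have "card (A - B) \<le> 3 * card (low_monomials p {..<m}) * card ({m..<n} \<rightarrow>\<^sub>E {0..<int p})"
  proof (rule card_fibres_le[where f = "\<lambda>x. restrict x {m..<n}"])
    show "(\<lambda>x. restrict x {m..<n}) ` (A - B) \<subseteq> {m..<n} \<rightarrow>\<^sub>E {0..<int p}"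
      using A by (intro image_subsetI) (auto simp: subset_iff Fp_vectors_iff PiE_iff)
    fix b
    show "card {x \<in> A - B. restrict x {m..<n} = b} \<le> 3 * card (low_monomials p {..<m})"
    proof (rule card_progression_free_le_low_monomials[OF p])
      fix x y z
      assume xyz: "x \<in> {x \<in> A - B. restrict x {m..<n} = b}" "y \<in> {x \<in> A - B. restrict x {m..<n} = b}"
        "z \<in> {x \<in> A - B. restrict x {m..<n} = b}"
        and ap: "\<And>i. i \<in> {..<m} \<Longrightarrow> int p dvd x i - 2 * y i + z i"
      have tail: "x i = y i \<and> y i = z i" if "i \<in> {m..<n}" for i
      proof -
        have "restrict x {m..<n} = restrict y {m..<n}" "restrict y {m..<n} = restrict z {m..<n}"
          using xyz by simp_all
        then show ?thesis using that by (metis restrict_apply')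
      qed
      have cong: "int p dvd x i - 2 * y i + z i" if "i < n" for i
        using ap[of i] tail[of i] that by (cases "i < m") auto
      then have "\<forall>i<n. [x i - 2 * y i + z i = 0] (mod int p)"
        by (simp add: cong_0_iff)
      \<comment> \<open>Within a coset the difference is supported on the first \<open>m\<close>
        coordinates; a nondegenerate progression would put its start \<open>x\<close> into
        \<open>B\<close>. Only coinciding points remain.\<close>
      moreover have "\<not> AP x y z" using xyz unfolding B_def by blast
      ultimately have "\<not> distinct [x, y, z]" using xyz tail unfolding AP_def by blast
      then have triv: "x = y \<or> y = z \<or> x = z" by auto
      have V: "x \<in> {..<n} \<rightarrow>\<^sub>E {0..<int p}" "y \<in> {..<n} \<rightarrow>\<^sub>E {0..<int p}" "z \<in> {..<n} \<rightarrow>\<^sub>E {0..<int p}"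
        using xyz A by (simp_all add: subset_iff flip: Fp_vectors_iff)
      \<comment> \<open>Oddness of \<open>p\<close> settles the case \<open>x = z\<close>, where the
        congruence reads \<open>2 * (x - y) = 0\<close>.\<close>
      have "coprime p 2" using primes_coprime[OF p two_is_prime_nat] p3 by simp
      then have coprime: "coprime (int p) 2" by (metis coprime_int_iff of_nat_numeral)
      have "x = y" if "y = z"
      proof (rule mod_eq_imp_eq_on_PiE[OF V(1,2)])
        fix i assume "i \<in> {..<n}"
        then show "[x i = y i] (mod int p)" using cong[of i] that by (simp add: cong_iff_dvd_diff)
      qed
      moreover have "y = z" if "x = y"
      proof (rule mod_eq_imp_eq_on_PiE[OF V(2,3)])
        fix i assume "i \<in> {..<n}"
        then have "int p dvd z i - y i" using cong[of i] that by simp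
        then show "[y i = z i] (mod int p)" by (simp add: cong_iff_dvd_diff dvd_diff_commute)
      qed
      moreover have "x = y" if "x = z"
      proof (rule mod_eq_imp_eq_on_PiE[OF V(1,2)])
        fix i assume "i \<in> {..<n}"
        then have "int p dvd 2 * (x i - y i)" using cong[of i] that by (simp add: algebra_simps)
        then show "[x i = y i] (mod int p)"
          unfolding cong_iff_dvd_diff coprime_dvd_mult_right_iff[OF coprime] .
      qed
      ultimately show "x = y \<and> y = z" using triv by metis
    qed (use finA in simp_all)
  qed (use finA in \<open>simp_all add: finite_PiE\<close>)
  then have "card (A - B) \<le> 3 * card (low_monomials p {..<m}) * p ^ (n - m)" by (simp add: card_PiE)
  moreover have "card A = card B + card (A - B)"
    using BA finA finB by (metis card_Diff_subset card_mono le_add_diff_inverse)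
  ultimately show ?thesis using card_B by simp
qed

lemma ex_W_sharp_upper:
  assumes p: "prime p" and p3: "p \<ge> 3"
  shows "real (ex_W_sharp p n) \<le> 10 * (49 / 50 * real p) ^ n"
proof -
  define m where "m = n div 2"
  have m: "m \<le> n" "n \<le> 2 * m + 1" "m \<le> n - m" by (auto simp: m_def)
  define l where "l = (91 / 96 :: real) ^ m"
  obtain A where A: "A \<subseteq> Fp_vectors p n" "W_sharp_free p n A" "card A = ex_W_sharp p n"
    by (rule ex_W_sharp_attained)
  have N: "real (card (low_monomials p {..<m})) \<le> l * real p ^ m"
    using card_low_monomials_le[of p "{..<m}"] p3
    unfolding power_mult_distrib l_def by simp
  have split: "real p ^ m * real p ^ (n - m) = real p ^ n" using m by (simp flip: power_add)
  have "real p ^ m \<le> l * real p ^ n"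
  proof -
    \<comment> \<open>Since \<open>m \<le> n - m\<close>, the discarded points also fit under the
      coset bound \<open>l * p ^ n\<close>.\<close>
    have "1 \<le> (91 / 96 * real p) ^ m" using p3 by (intro one_le_power) simp
    also have "\<dots> = l * real p ^ m" by (simp only: l_def power_mult_distrib)
    also have "\<dots> \<le> l * real p ^ (n - m)"
      using p3 m by (intro mult_left_mono power_increasing) (auto simp: l_def)
    finally have "real p ^ m * 1 \<le> real p ^ m * (l * real p ^ (n - m))" by (intro mult_left_mono) auto
    then show ?thesis by (simp add: mult.left_commute split)
  qed
  moreover have "real (card (low_monomials p {..<m})) * real p ^ (n - m) \<le> l * real p ^ n"
    using mult_right_mono[OF N, of "real p ^ (n - m)"] by (simp add: mult.assoc split)
  moreover have "real (ex_W_sharp p n) \<le> real (6 * p ^ m + 3 * card (low_monomials p {..<m}) * p ^ (n - m))"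
    unfolding of_nat_le_iff using card_W_sharp_free_le[OF p p3 m(1) A(1,2)] A(3) by simp
  ultimately have "real (ex_W_sharp p n) \<le> 9 * l * real p ^ n" by simp
  \<comment> \<open>\<open>91/96 \<le> (49/50) ^ 2\<close> converts the exponent \<open>m\<close> to
    \<open>2 * m\<close>; the factor \<open>50/49\<close> pays for odd \<open>n\<close>, and
    \<open>9 * 50/49 \<le> 10\<close>.\<close>
  also have "9 * l \<le> 10 * (49 / 50) ^ n"
  proof -
    have "l \<le> ((49 / 50) ^ 2) ^ m" unfolding l_def by (intro power_mono) (auto simp: power2_eq_square)
    also have "\<dots> = 50 / 49 * (49 / 50) ^ (2 * m + 1)" by (simp add: power_mult)
    also have "\<dots> \<le> 50 / 49 * (49 / 50) ^ n" using m by (intro mult_left_mono power_decreasing) auto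
    finally have "l \<le> 50 / 49 * (49 / 50) ^ n" .
    moreover have "0 \<le> (49 / 50 :: real) ^ n" by simp
    ultimately show ?thesis by linarith
  qed
  then have "9 * l * real p ^ n \<le> 10 * (49 / 50) ^ n * real p ^ n" by (intro mult_right_mono) auto
  finally show ?thesis by (simp only: power_mult_distrib mult.assoc)
qed

text \<open>Slightly worse bases absorb the remaining factors: passing from \<open>1/2\<close> to
  \<open>1/4\<close> gains \<open>2 ^ n\<close> against \<open>n * p ^ 2 + 1\<close>, and passing
  from \<open>49/50\<close> to \<open>99/100\<close> gains \<open>(99/98) ^ n\<close> against 10.
  The bases do not depend on \<open>p\<close>.\<close>

lemma eventually_ex_W_sharp_bounds:
  assumes p: "prime p" and p3: "p \<ge> 3"
  shows "\<forall>\<^sub>F n in sequentially. (1 / 4 * real p) ^ n \<le> real (ex_W_sharp p n) \<and>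
    real (ex_W_sharp p n) \<le> (99 / 100 * real p) ^ n"
proof -
  have "(\<lambda>n. real p ^ 2 * (real n * (1 / 2) ^ n) + (1 / 2) ^ n) \<longlonglongrightarrow> real p ^ 2 * 0 + 0"
    by (intro tendsto_intros powser_times_n_limit_0 LIMSEQ_realpow_zero) auto
  then have "\<forall>\<^sub>F n in sequentially. real p ^ 2 * (real n * (1 / 2) ^ n) + (1 / 2) ^ n < 1"
    by (rule order_tendstoD) simp
  then have "\<forall>\<^sub>F n in sequentially. real (n * p ^ 2 + 1) \<le> 2 ^ n"
    by eventually_elim (simp add: power_divide field_simps)
  moreover have "\<forall>\<^sub>F n in sequentially. (98 / 99 :: real) ^ n < 1 / 10"
    by (rule order_tendstoD[OF LIMSEQ_realpow_zero]) simp_all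
  then have "\<forall>\<^sub>F n in sequentially. 10 \<le> (99 / 98 :: real) ^ n"
    by eventually_elim (simp add: power_divide field_simps)
  ultimately show ?thesis
  proof eventually_elim
    case (elim n)
    have "2 ^ n * (1 / 4 * real p) ^ n = (real p / 2) ^ n"
      unfolding power_mult_distrib[symmetric] by simp
    also have "\<dots> \<le> real (ex_W_sharp p n) * real (n * p ^ 2 + 1)"
      using p3 by (intro ex_W_sharp_lower) auto
    also have "\<dots> \<le> real (ex_W_sharp p n) * 2 ^ n" using elim by (intro mult_left_mono) auto
    finally have "(1 / 4 * real p) ^ n \<le> real (ex_W_sharp p n)" by simp
    moreover have "real (ex_W_sharp p n) \<le> 10 * (49 / 50 * real p) ^ n" by (rule ex_W_sharp_upper[OF p p3])
    moreover have "10 * (49 / 50 * real p) ^ n \<le> (99 / 98) ^ n * (49 / 50 * real p) ^ n"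
      using elim by (intro mult_right_mono) auto
    moreover have "(99 / 98) ^ n * (49 / 50 * real p) ^ n = (99 / 100 * real p) ^ n"
      unfolding power_mult_distrib[symmetric] by simp
    ultimately show ?case by simp
  qed
qed

theorem theorem1p1:
  shows "\<exists>c1 c2 :: real. 0 < c1 \<and> c1 < c2 \<and> c2 < 1 \<and>
    (\<forall>p::nat. prime p \<longrightarrow> p \<ge> 3 \<longrightarrow>
      (\<exists>n0::nat. \<forall>n\<ge>n0.
        (c1 * real p) ^ n \<le> real (ex_W_sharp p n) \<and>
        real (ex_W_sharp p n) \<le> (c2 * real p) ^ n))"
  using eventually_ex_W_sharp_bounds[unfolded eventually_sequentially]
  by - (rule exI[of _ "1 / 4"], rule exI[of _ "99 / 100"], simp)

end
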